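(* $\tilde{r}(C_4,P_6)=11$, where $\tilde{r}(G,H)$ denotes the online size Ramsey number of the graphs $G$ and $H$, $C_4$ is the cycle on $4$ vertices, and $P_6$ is the path on $6$ vertices (with $5$ edges). That is, in the Builder–Painter game on the edge set of the infinite clique $K_{\mathbb{N}}$, Builder has a strategy guaranteeing that after at most $11$ rounds there is a red copy of $C_4$ or a blue copy of $P_6$, and Builder has no strategy guaranteeing this after at most $10$ rounds.
   Context: Let $G$ and $H$ be fixed finite graphs. The $\tilde{R}(G,H)$-game is played by two players, Builder and Painter, on the edge set of the infinite clique $K_{\mathbb{N}}$ (the complete graph with vertex set $\mathbb{N}$). Initially no edge is chosen or colored. In each round Builder chooses an edge of $K_{\mathbb{N}}$ (not chosen before), and Painter immediately colors it red or blue; both players see all previous choices and colors. Builder wins as soon as the colored edges contain a red copy of $G$ (a subgraph isomorphic to $G$, not necessarily induced, all of whose edges are red) or a blue copy of $H$ (a subgraph isomorphic to $H$, not necessarily induced, all of whose edges are blue). Builder wants to win in as few rounds as possible, and Painter wants to delay this for as many rounds as possible. The online size Ramsey number $\tilde{r}(G,H)$ is the minimum number of rounds within which Builder can win, assuming both players play optimally; i.e. the least $t$ such that Builder has a strategy which, against every play of Painter, produces a red copy of $G$ or a blue copy of $H$ after at most $t$ rounds. Here $C_k$ denotes the cycle on $k$ vertices and $P_k$ denotes the path on $k$ vertices. *)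

theory Defs
  imports Main "HOL-Library.Extended_Nat"
begin

type_synonym 'a graph = "'a set \<times> 'a set set"

text \<open>A cycle for \<open>k \<ge> 3\<close>; for smaller \<open>k\<close> the edge set degenerates.\<close>

definition cycle_graph :: "nat \<Rightarrow> nat graph" where
  "cycle_graph k = ({..<k}, {{i, Suc i mod k} | i. i < k})"

text \<open>The parameter is the number of vertices, so the path has \<open>k - 1\<close> edges.\<close>

definition path_graph :: "nat \<Rightarrow> nat graph" where
  "path_graph k = ({..<k}, {{i, Suc i} | i. Suc i < k})"

definition clique_edges :: "nat set set" where
  "clique_edges = {{u, v} | u v. u \<noteq> v}"

text \<open>Copies are not necessarily induced.\<close>

definition contains_copy :: "nat set set \<Rightarrow> 'a graph \<Rightarrow> bool" where
  "contains_copy F G \<longleftrightarrow>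
     (\<exists>f :: 'a \<Rightarrow> nat. inj_on f (fst G) \<and> (\<forall>e \<in> snd G. f ` e \<in> F))"

datatype color = Red | Blue

text \<open>The rounds played so far, the oldest one first.\<close>

type_synonym history = "(nat set \<times> color) list"

definition chosen_edges :: "history \<Rightarrow> nat set set" where
  "chosen_edges h = fst ` set h"

definition colored_edges :: "history \<Rightarrow> color \<Rightarrow> nat set set" where
  "colored_edges h c = {e. (e, c) \<in> set h}"

definition builder_won :: "'a graph \<Rightarrow> 'b graph \<Rightarrow> history \<Rightarrow> bool" where
  "builder_won G H h \<longleftrightarrow>
     contains_copy (colored_edges h Red) G \<or> contains_copy (colored_edges h Blue) H"

type_synonym builder_strategy = "history \<Rightarrow> nat set"
type_synonym painter_strategy = "history \<Rightarrow> nat set \<Rightarrow> color"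

text \<open>Legality is required after every history. This is no restriction on Builder:
  only finitely many edges have been chosen, so an unchosen edge always exists.\<close>

definition legal_builder :: "builder_strategy \<Rightarrow> bool" where
  "legal_builder \<beta> \<longleftrightarrow> (\<forall>h. \<beta> h \<in> clique_edges - chosen_edges h)"

text \<open>The play is continued formally after Builder has won. This is harmless, because
  a monochromatic copy persists in every longer history.\<close>

primrec play :: "builder_strategy \<Rightarrow> painter_strategy \<Rightarrow> nat \<Rightarrow> history" where
  "play \<beta> \<pi> 0 = []"
| "play \<beta> \<pi> (Suc n) =
     (let h = play \<beta> \<pi> n; e = \<beta> h in h @ [(e, \<pi> h e)])"

definition builder_wins_within :: "'a graph \<Rightarrow> 'b graph \<Rightarrow> nat \<Rightarrow> bool" where
  "builder_wins_within G H t \<longleftrightarrow>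
     (\<exists>\<beta>. legal_builder \<beta> \<and> (\<forall>\<pi>. \<exists>s \<le> t. builder_won G H (play \<beta> \<pi> s)))"

text \<open>The value is \<open>\<infinity>\<close> if no number of rounds suffices; otherwise the infimum
  is the least sufficient number of rounds.\<close>

definition online_size_ramsey :: "'a graph \<Rightarrow> 'b graph \<Rightarrow> enat" where
  "online_size_ramsey G H = (INF t \<in> {t. builder_wins_within G H t}. enat t)"

end

theory Submission
  imports Defs
begin

text \<open>Lower bound: Painter colours an edge red unless this would close a red \<open>C\<^sub>4\<close>. Then the ends of
  every blue edge are joined by a red path with three edges. If a blue \<open>P\<^sub>6\<close> occurred with at most
  five red edges, the red edges would form a spanning tree on its six vertices, and the blue path
  would split them into two colour classes of size three. But then all ten
  edges would join the two classes, which admit only nine pairs. So at least six red edges and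
  five blue ones are needed.

  Upper bound: an explicit decision tree of depth 11 on seven vertices, found by computer search.\<close>

section \<open>Edges of a history by colour, and copies given by vertex lists\<close>

lemma finite_colored_edges [simp]: "finite (colored_edges h c)"
proof -
  have "colored_edges h c \<subseteq> fst ` set h"
    by (force simp: colored_edges_def)
  then show ?thesis
    by (rule finite_subset) simp
qed

lemma colored_edges_Nil [simp]: "colored_edges [] c = {}"
  by (simp add: colored_edges_def)

lemma colored_edges_snoc:
  "colored_edges (h @ [(e, d)]) c = (if d = c then insert e (colored_edges h c) else colored_edges h c)"
  by (auto simp: colored_edges_def)

lemma chosen_edges_eq: "chosen_edges h = colored_edges h Red \<union> colored_edges h Blue"
proof -
  have "e \<in> chosen_edges h \<longleftrightarrow> (\<exists>c. (e, c) \<in> set h)" for e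
    by (force simp: chosen_edges_def)
  then show ?thesis
    unfolding colored_edges_def by (auto, metis color.exhaust)
qed

lemma contains_copy_path_graph_iff:
  "contains_copy F (path_graph k) \<longleftrightarrow>
    (\<exists>f. inj_on f {..<k} \<and> (\<forall>i. Suc i < k \<longrightarrow> {f i, f (Suc i)} \<in> F))"
proof -
  have "(\<forall>e \<in> {{i, Suc i} | i. Suc i < k}. f ` e \<in> F) \<longleftrightarrow>
      (\<forall>i. Suc i < k \<longrightarrow> {f i, f (Suc i)} \<in> F)" for f :: "nat \<Rightarrow> nat"
    by (simp add: setcompr_eq_image)
  then show ?thesis
    by (simp add: contains_copy_def path_graph_def)
qed

lemma contains_copy_cycle_graph_iff:
  "contains_copy F (cycle_graph k) \<longleftrightarrow>
    (\<exists>f. inj_on f {..<k} \<and> (\<forall>i<k. {f i, f (Suc i mod k)} \<in> F))"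
proof -
  have "(\<forall>e \<in> {{i, Suc i mod k} | i. i < k}. f ` e \<in> F) \<longleftrightarrow>
      (\<forall>i<k. {f i, f (Suc i mod k)} \<in> F)" for f :: "nat \<Rightarrow> nat"
    by (simp add: setcompr_eq_image)
  then show ?thesis
    by (simp add: contains_copy_def cycle_graph_def)
qed

text \<open>Serves the leaves of the decision tree: for a concrete vertex list the hypotheses can be
  evaluated, and \<open>(!) vs\<close> is then the embedding.\<close>

lemma contains_copy_path_graph:
  assumes "distinct vs" and "\<forall>(u, v) \<in> set (zip vs (tl vs)). {u, v} \<in> F"
  shows "contains_copy F (path_graph (length vs))"
proof -
  have "{vs ! i, vs ! Suc i} \<in> F" if "Suc i < length vs" for i
  proof -
    have "(vs ! i, vs ! Suc i) \<in> set (zip vs (tl vs))"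
      using that by (force simp: in_set_zip nth_tl)
    then show ?thesis
      using assms(2) by blast
  qed
  then show ?thesis
    unfolding contains_copy_path_graph_iff using assms(1)
    by (intro exI[of _ "(!) vs"]) (simp add: inj_on_nth)
qed

text \<open>Zipping with \<open>rotate1 vs\<close> instead of \<open>tl vs\<close> adds the pair of
  last and first vertex, which closes the cycle.\<close>

lemma contains_copy_cycle_graph:
  assumes "distinct vs" and "\<forall>(u, v) \<in> set (zip vs (rotate1 vs)). {u, v} \<in> F"
  shows "contains_copy F (cycle_graph (length vs))"
proof -
  have "{vs ! i, vs ! (Suc i mod length vs)} \<in> F" if "i < length vs" for i
  proof -
    have "(vs ! i, vs ! (Suc i mod length vs)) \<in> set (zip vs (rotate1 vs))"
      using that by (force simp: in_set_zip nth_rotate1)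
    then show ?thesis
      using assms(2) by blast
  qed
  then show ?thesis
    unfolding contains_copy_cycle_graph_iff using assms(1)
    by (intro exI[of _ "(!) vs"]) (simp add: inj_on_nth)
qed

section \<open>Forced wins of Builder\<close>

text \<open>Backward induction on the number of rounds left. Painter enters only through the colour
  of the next edge, so no strategy functions are involved.\<close>

primrec forces :: "'a graph \<Rightarrow> 'b graph \<Rightarrow> nat \<Rightarrow> history \<Rightarrow> bool" where
  "forces G H 0 h = builder_won G H h"
| "forces G H (Suc n) h =
     (builder_won G H h \<or> (\<exists>e \<in> clique_edges - chosen_edges h. \<forall>c. forces G H n (h @ [(e, c)])))"

lemma clique_edges_infinite: "infinite clique_edges"
proof -
  have "inj (\<lambda>n::nat. {0, Suc n})"
    by (auto simp: inj_def doubleton_eq_iff)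
  moreover have "range (\<lambda>n::nat. {0, Suc n}) \<subseteq> clique_edges"
    by (auto simp: clique_edges_def)
  ultimately show ?thesis
    by (metis finite_imageD finite_subset infinite_UNIV_nat)
qed

text \<open>Supplies the default move: a legal Builder must answer every history, including those
  that never arise in his own play.\<close>

lemma unchosen_edge_exists: "\<exists>e. e \<in> clique_edges - chosen_edges h"
proof -
  have "finite (chosen_edges h)"
    by (simp add: chosen_edges_def)
  then have "infinite (clique_edges - chosen_edges h)"
    using clique_edges_infinite by simp
  then show ?thesis
    by (metis ex_in_conv finite.emptyI)
qed

lemma length_play [simp]: "length (play \<beta> \<pi> n) = n"
  by (induction n) (auto simp: Let_def)

text \<open>Builder always picks an edge that keeps the win forced. The number of rounds left can be
  read off the length of the history, so this choice is a function of the history alone.\<close>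

lemma builder_wins_within_if_forces:
  assumes "forces G H t []"
  shows "builder_wins_within G H t"
proof -
  \<comment> \<open>\<open>t - Suc (length h)\<close> rounds remain once the edge \<open>e\<close>
    has been coloured.\<close>
  define good where "good h e \<longleftrightarrow> e \<in> clique_edges - chosen_edges h \<and>
    (\<forall>c. forces G H (t - Suc (length h)) (h @ [(e, c)]))" for h e
  define \<beta> where "\<beta> h = (if \<exists>e. good h e then SOME e. good h e
    else SOME e. e \<in> clique_edges - chosen_edges h)" for h
  have good: "good h (\<beta> h)" if "good h e" for h e
    using that someI[of "good h" e] by (auto simp: \<beta>_def)
  have "\<beta> h \<in> clique_edges - chosen_edges h" for h
  proof (cases "\<exists>e. good h e")
    case True
    then show ?thesis
      using good good_def by blast
  next
    case False
    then show ?thesis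
      using someI_ex[OF unchosen_edge_exists[of h]] by (simp add: \<beta>_def del: Diff_iff)
  qed
  then have "legal_builder \<beta>"
    by (simp add: legal_builder_def)
  moreover have "\<exists>s \<le> t. builder_won G H (play \<beta> \<pi> s)" for \<pi>
  proof (rule ccontr)
    assume not_won: "\<not> ?thesis"
    \<comment> \<open>As long as Builder has not won, the forced win survives each round. At
      \<open>n = t\<close> no round is left, and \<open>forces\<close> with 0 rounds means that he
      has won.\<close>
    have "forces G H (t - n) (play \<beta> \<pi> n)" if "n \<le> t" for n
      using that
    proof (induction n)
      case 0
      then show ?case
        using assms by simp
    next
      case (Suc n)
      let ?h = "play \<beta> \<pi> n"
      have "forces G H (Suc (t - Suc n)) ?h"
        using Suc by (simp add: Suc_diff_Suc)
      moreover have "\<not> builder_won G H ?h"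
        using not_won Suc.prems by simp
      ultimately obtain e where "good ?h e"
        by (auto simp: good_def)
      then have "good ?h (\<beta> ?h)"
        by (rule good)
      then show ?case
        by (simp add: good_def Let_def)
    qed
    from this[of t] not_won show False
      by simp
  qed
  ultimately show ?thesis
    unfolding builder_wins_within_def by blast
qed

section \<open>Decision trees as certificates for Builder\<close>

text \<open>A leaf lists the vertices of the finished red cycle or blue path in order. In
  \<open>Ask u v s t\<close>, play continues with \<open>s\<close> if the edge is coloured red and
  with \<open>t\<close> if blue.\<close>

datatype strategy =
  Cycle "nat list"
| Path "nat list"
| Ask nat nat strategy strategy

text \<open>Edges are stored as pairs with the smaller end first.\<close>

definition listed :: "(nat \<times> nat) list \<Rightarrow> nat \<times> nat \<Rightarrow> bool" where
  "listed E = (\<lambda>(u, v). (if u < v then (u, v) else (v, u)) \<in> set E)"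

text \<open>An executable counterpart of \<open>forces\<close>, with the red and blue edges in
  \<open>R\<close> and \<open>B\<close>. The test \<open>u < v\<close> keeps the pairs normalised,
  so that freshness of an edge is a plain membership test. A leaf may be reached with rounds to
  spare.\<close>

fun valid :: "nat \<Rightarrow> (nat \<times> nat) list \<Rightarrow> (nat \<times> nat) list \<Rightarrow> strategy \<Rightarrow> bool" where
  "valid n R B (Cycle vs) \<longleftrightarrow> length vs = 4 \<and> distinct vs \<and> list_all (listed R) (zip vs (rotate1 vs))"
| "valid n R B (Path vs) \<longleftrightarrow> length vs = 6 \<and> distinct vs \<and> list_all (listed B) (zip vs (tl vs))"
| "valid n R B (Ask u v s t) \<longleftrightarrow> n > 0 \<and> u < v \<and> (u, v) \<notin> set R \<and> (u, v) \<notin> set B \<and>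
     valid (n - 1) ((u, v) # R) B s \<and> valid (n - 1) R ((u, v) # B) t"

definition edge_set :: "(nat \<times> nat) list \<Rightarrow> nat set set" where
  "edge_set E = (\<lambda>(u, v). {u, v}) ` set E"

lemma edge_set_Cons [simp]: "edge_set ((u, v) # E) = insert {u, v} (edge_set E)"
  by (simp add: edge_set_def)

lemma edge_set_if_listed: "listed E (u, v) \<Longrightarrow> {u, v} \<in> edge_set E"
  by (force simp: listed_def edge_set_def insert_commute split: if_splits)

text \<open>Soundness of the checker, by induction along its recursion: a leaf is a win already, and
  an \<open>Ask\<close> node supplies the edge that \<open>forces\<close> demands.\<close>

lemma forces_if_valid:
  assumes "valid n R B s" and "\<forall>(u, v) \<in> set R \<union> set B. u < v"
    and "colored_edges h Red = edge_set R" and "colored_edges h Blue = edge_set B"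
  shows "forces (cycle_graph 4) (path_graph 6) n h"
  using assms
proof (induction n R B s arbitrary: h rule: valid.induct)
  case (1 n R B vs)
  then have "distinct vs" "length vs = 4" "\<forall>(u, v) \<in> set (zip vs (rotate1 vs)). {u, v} \<in> edge_set R"
    by (auto simp: list_all_iff intro: edge_set_if_listed)
  then have "contains_copy (colored_edges h Red) (cycle_graph 4)"
    using contains_copy_cycle_graph[of vs "edge_set R"] 1 by simp
  then show ?case
    by (cases n) (simp_all add: builder_won_def)
next
  case (2 n R B vs)
  then have "distinct vs" "length vs = 6" "\<forall>(u, v) \<in> set (zip vs (tl vs)). {u, v} \<in> edge_set B"
    by (auto simp: list_all_iff intro: edge_set_if_listed)
  then have "contains_copy (colored_edges h Blue) (path_graph 6)"
    using contains_copy_path_graph[of vs "edge_set B"] 2 by simp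
  then show ?case
    by (cases n) (simp_all add: builder_won_def)
next
  case (3 n R B u v s t)
  have uv: "u < v" "(u, v) \<notin> set R" "(u, v) \<notin> set B"
    using "3.prems"(1) by simp_all
  \<comment> \<open>The edge \<open>{u, v}\<close> could also stem from the reversed pair;
    normalisation rules this out.\<close>
  moreover have "(v, u) \<notin> set R \<union> set B"
    using uv(1) "3.prems"(2) bspec[OF "3.prems"(2), of "(v, u)"] by auto
  ultimately have "{u, v} \<notin> edge_set R \<union> edge_set B"
    by (auto simp: edge_set_def doubleton_eq_iff)
  then have "{u, v} \<in> clique_edges - chosen_edges h"
    using uv(1) "3.prems"(3,4) by (auto simp: clique_edges_def chosen_edges_eq)
  moreover have "forces (cycle_graph 4) (path_graph 6) (n - 1) (h @ [({u, v}, c)])" for c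
    using 3 by (cases c) (simp_all add: colored_edges_snoc)
  ultimately show ?case
    using "3.prems"(1) by (cases n) auto
qed

text \<open>The tree opens with the edge 01. After red it continues with the adjacent edge 02, after
  blue with the disjoint edge 23.\<close>

definition builder_tree :: strategy where
  "builder_tree =
    (Ask 0 1 (Ask 0 2 (Ask 1 3 (Ask 2 3 (Cycle [0,1,3,2]) (Ask 0 4 (Ask 1 2 (Ask 0 3
    (Cycle [0,2,1,3]) (Ask 1 4 (Cycle [0,2,1,4]) (Ask 2 4 (Cycle [0,1,2,4]) (Ask 0 5 (Ask 1 5
    (Cycle [0,2,1,5]) (Path [0,3,2,4,1,5])) (Path [1,4,2,3,0,5]))))) (Ask 3 4 (Cycle [0,1,3,4])
    (Ask 1 5 (Ask 4 5 (Cycle [0,1,5,4]) (Ask 0 3 (Ask 0 5 (Cycle [0,3,1,5]) (Path [0,5,4,3,2,1]))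
    (Ask 2 5 (Cycle [0,1,5,2]) (Path [0,3,4,5,2,1])))) (Ask 0 5 (Ask 4 6 (Ask 5 6 (Cycle [0,4,6,5])
    (Path [4,3,2,1,5,6])) (Path [5,1,2,3,4,6])) (Path [0,5,1,2,3,4]))))) (Ask 1 5 (Ask 2 5
    (Cycle [0,1,5,2]) (Ask 3 4 (Ask 4 5 (Cycle [1,3,4,5]) (Ask 0 6 (Ask 3 6 (Cycle [0,1,3,6])
    (Path [0,4,5,2,3,6])) (Path [3,2,5,4,0,6]))) (Ask 0 6 (Ask 5 6 (Cycle [0,1,5,6])
    (Path [0,4,3,2,5,6])) (Path [5,2,3,4,0,6])))) (Ask 0 5 (Ask 3 5 (Cycle [0,1,3,5]) (Ask 1 4
    (Ask 2 4 (Cycle [0,1,4,2]) (Path [0,4,2,3,5,1])) (Path [0,4,1,5,3,2]))) (Ask 1 2 (Ask 2 4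
    (Ask 3 4 (Cycle [1,2,4,3]) (Path [1,5,0,4,3,2])) (Path [1,5,0,4,2,3])) (Path [3,2,1,5,0,4]))))))
    (Ask 2 4 (Ask 0 5 (Ask 4 5 (Cycle [0,2,4,5]) (Ask 2 5 (Ask 0 4 (Cycle [0,4,2,5]) (Ask 1 2
    (Cycle [0,1,2,5]) (Ask 0 3 (Ask 3 5 (Cycle [0,2,5,3]) (Path [0,4,5,3,1,2]))
    (Path [2,1,3,0,4,5])))) (Ask 1 4 (Cycle [0,1,4,2]) (Ask 0 3 (Ask 2 6 (Ask 3 6 (Cycle [0,2,6,3])
    (Path [2,5,4,1,3,6])) (Path [3,1,4,5,2,6])) (Path [0,3,1,4,5,2]))))) (Ask 1 4 (Cycle [0,1,4,2])
    (Ask 0 6 (Ask 4 6 (Cycle [0,2,4,6]) (Ask 0 3 (Ask 3 5 (Ask 5 6 (Cycle [0,3,5,6])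
    (Path [0,5,6,4,1,3])) (Path [0,5,3,1,4,6])) (Path [5,0,3,1,4,6]))) (Ask 3 5 (Ask 3 6 (Ask 4 5
    (Ask 4 6 (Cycle [3,5,4,6]) (Path [3,1,4,6,0,5])) (Path [3,1,4,5,0,6])) (Path [4,1,3,6,0,5]))
    (Path [4,1,3,5,0,6]))))) (Ask 1 5 (Ask 2 5 (Cycle [0,1,5,2]) (Ask 0 3 (Ask 3 5 (Cycle [0,1,5,3])
    (Ask 0 4 (Ask 1 6 (Ask 4 6 (Cycle [0,1,6,4]) (Path [1,3,5,2,4,6])) (Path [4,2,5,3,1,6]))
    (Path [0,4,2,5,3,1]))) (Ask 0 4 (Ask 0 5 (Ask 1 4 (Cycle [0,4,1,5]) (Path [0,3,1,4,2,5]))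
    (Path [1,3,0,5,2,4])) (Path [1,3,0,4,2,5])))) (Ask 0 3 (Ask 2 6 (Ask 3 6 (Cycle [0,2,6,3])
    (Ask 2 5 (Ask 4 5 (Ask 4 6 (Cycle [2,5,4,6]) (Path [2,4,6,3,1,5])) (Path [2,4,5,1,3,6]))
    (Path [4,2,5,1,3,6]))) (Ask 3 4 (Ask 0 5 (Ask 4 5 (Cycle [0,3,4,5]) (Path [3,1,5,4,2,6]))
    (Ask 1 4 (Cycle [0,1,4,3]) (Path [0,5,1,4,2,6]))) (Path [5,1,3,4,2,6]))) (Ask 0 4 (Ask 2 5
    (Ask 4 5 (Cycle [0,2,5,4]) (Path [0,3,1,5,4,2])) (Path [0,3,1,5,2,4])) (Path [2,4,0,3,1,5]))))))
    (Ask 1 3 (Ask 3 4 (Ask 0 4 (Cycle [0,1,3,4]) (Ask 1 5 (Ask 4 5 (Cycle [1,3,4,5]) (Ask 3 5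
    (Ask 1 6 (Ask 3 6 (Cycle [1,5,3,6]) (Ask 5 6 (Cycle [1,3,5,6]) (Path [2,0,4,5,6,3]))) (Ask 0 5
    (Cycle [0,1,3,5]) (Ask 1 4 (Cycle [1,4,3,5]) (Path [2,0,5,4,1,6])))) (Ask 1 2 (Ask 2 6 (Ask 3 6
    (Cycle [1,2,6,3]) (Path [2,0,4,5,3,6])) (Path [3,5,4,0,2,6])) (Path [1,2,0,4,5,3])))) (Ask 1 6
    (Ask 4 6 (Cycle [1,3,4,6]) (Ask 1 2 (Ask 2 5 (Ask 5 6 (Cycle [1,2,5,6]) (Path [1,5,6,4,0,2]))
    (Path [1,5,2,0,4,6])) (Path [5,1,2,0,4,6]))) (Ask 2 5 (Ask 2 6 (Ask 4 5 (Ask 4 6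
    (Cycle [2,5,4,6]) (Path [2,0,4,6,1,5])) (Path [2,0,4,5,1,6])) (Path [4,0,2,6,1,5]))
    (Path [4,0,2,5,1,6]))))) (Ask 0 5 (Ask 3 5 (Cycle [0,1,3,5]) (Ask 1 2 (Ask 2 5 (Cycle [0,1,2,5])
    (Ask 0 6 (Ask 1 4 (Ask 4 6 (Cycle [0,1,4,6]) (Path [0,2,5,3,4,6])) (Path [0,2,5,3,4,1]))
    (Path [4,3,5,2,0,6]))) (Ask 0 4 (Ask 1 4 (Ask 1 5 (Cycle [0,4,1,5]) (Path [0,2,1,5,3,4]))
    (Path [0,2,1,4,3,5])) (Path [1,2,0,4,3,5])))) (Ask 1 2 (Ask 2 6 (Ask 0 6 (Cycle [0,1,2,6])
    (Ask 3 6 (Cycle [1,2,6,3]) (Ask 1 5 (Ask 5 6 (Cycle [1,2,6,5]) (Path [2,0,5,6,3,4]))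
    (Path [1,5,0,6,3,4])))) (Ask 3 5 (Ask 3 6 (Ask 4 5 (Ask 4 6 (Cycle [3,5,4,6])
    (Path [3,4,6,2,0,5])) (Path [3,4,5,0,2,6])) (Path [4,3,6,2,0,5])) (Path [4,3,5,0,2,6])))
    (Ask 1 4 (Ask 3 5 (Ask 4 5 (Cycle [1,3,5,4]) (Path [1,2,0,5,4,3])) (Path [1,2,0,5,3,4]))
    (Path [3,4,1,2,0,5]))))) (Ask 0 4 (Ask 4 5 (Ask 1 5 (Cycle [0,1,5,4]) (Ask 0 6 (Ask 5 6
    (Cycle [0,4,5,6]) (Ask 0 3 (Ask 2 3 (Ask 2 6 (Cycle [0,3,2,6]) (Path [0,2,6,5,1,3]))
    (Path [0,2,3,1,5,6])) (Path [2,0,3,1,5,6]))) (Ask 2 3 (Ask 2 5 (Ask 3 6 (Ask 5 6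
    (Cycle [2,3,6,5]) (Path [2,0,6,5,1,3])) (Path [2,0,6,3,1,5])) (Path [3,1,5,2,0,6]))
    (Path [5,1,3,2,0,6])))) (Ask 1 2 (Ask 2 4 (Cycle [0,1,2,4]) (Ask 0 3 (Ask 1 5 (Ask 3 5
    (Cycle [0,1,5,3]) (Path [0,2,4,5,3,1])) (Path [0,2,4,5,1,3])) (Path [1,3,0,2,4,5]))) (Ask 0 5
    (Ask 3 4 (Ask 3 5 (Cycle [0,4,3,5]) (Path [0,2,1,3,5,4])) (Path [0,2,1,3,4,5]))
    (Path [3,1,2,0,5,4])))) (Ask 1 2 (Ask 1 4 (Ask 2 3 (Ask 3 4 (Cycle [1,2,3,4]) (Ask 2 5 (Ask 0 5
    (Cycle [0,1,2,5]) (Ask 4 5 (Cycle [1,2,5,4]) (Path [1,3,4,5,0,2]))) (Path [1,3,4,0,2,5])))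
    (Ask 4 5 (Ask 0 5 (Cycle [0,1,4,5]) (Ask 2 5 (Cycle [1,2,5,4]) (Path [1,3,2,5,0,4])))
    (Path [1,3,2,0,4,5]))) (Ask 2 5 (Ask 2 6 (Ask 3 5 (Ask 3 6 (Cycle [2,5,3,6])
    (Path [2,0,4,1,3,6])) (Path [2,0,4,1,3,5])) (Path [3,1,4,0,2,6])) (Path [3,1,4,0,2,5])))
    (Ask 3 5 (Ask 3 6 (Ask 4 5 (Ask 4 6 (Cycle [3,5,4,6]) (Path [3,1,2,0,4,6]))
    (Path [3,1,2,0,4,5])) (Path [4,0,2,1,3,6])) (Path [4,0,2,1,3,5])))))) (Ask 2 3 (Ask 2 4 (Ask 3 5
    (Ask 4 5 (Cycle [2,3,5,4]) (Ask 0 2 (Ask 3 4 (Ask 0 3 (Cycle [0,2,4,3]) (Ask 2 5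
    (Cycle [2,4,3,5]) (Ask 1 2 (Ask 1 4 (Cycle [1,2,3,4]) (Path [2,5,4,1,0,3]))
    (Path [3,0,1,2,5,4])))) (Ask 0 5 (Cycle [0,2,3,5]) (Ask 1 2 (Ask 1 6 (Ask 3 6 (Cycle [1,2,3,6])
    (Path [1,0,5,4,3,6])) (Path [3,4,5,0,1,6])) (Path [2,1,0,5,4,3])))) (Ask 1 3 (Ask 1 4
    (Cycle [1,3,2,4]) (Ask 2 6 (Ask 5 6 (Cycle [2,3,5,6]) (Path [2,0,1,4,5,6]))
    (Path [5,4,1,0,2,6]))) (Ask 2 5 (Ask 3 4 (Cycle [2,4,3,5]) (Path [2,0,1,3,4,5]))
    (Path [3,1,0,2,5,4]))))) (Ask 4 6 (Ask 3 6 (Cycle [2,3,6,4]) (Ask 0 2 (Ask 0 6 (Cycle [0,2,4,6])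
    (Ask 1 2 (Ask 0 4 (Ask 1 4 (Cycle [0,2,1,4]) (Path [4,1,0,6,3,5])) (Ask 1 6 (Cycle [1,2,4,6])
    (Path [4,0,1,6,3,5]))) (Path [2,1,0,6,3,5]))) (Ask 1 5 (Ask 1 6 (Ask 2 5 (Ask 2 6
    (Cycle [1,5,2,6]) (Path [1,0,2,6,3,5])) (Path [1,0,2,5,3,6])) (Path [2,0,1,6,3,5]))
    (Path [2,0,1,5,3,6])))) (Ask 0 3 (Ask 0 4 (Cycle [0,3,2,4]) (Ask 1 3 (Ask 0 5 (Ask 1 5
    (Cycle [0,3,1,5]) (Path [3,5,1,0,4,6])) (Ask 1 4 (Cycle [1,3,2,4]) (Path [3,5,0,1,4,6])))
    (Path [5,3,1,0,4,6]))) (Ask 1 4 (Ask 1 6 (Ask 4 5 (Ask 5 6 (Cycle [1,4,5,6])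
    (Path [1,0,3,5,6,4])) (Path [1,0,3,5,4,6])) (Path [4,6,1,0,3,5])) (Path [5,3,0,1,4,6])))))
    (Ask 2 5 (Ask 0 3 (Ask 0 5 (Cycle [0,3,2,5]) (Ask 3 4 (Ask 4 5 (Cycle [2,3,4,5]) (Ask 1 3
    (Ask 1 6 (Ask 2 6 (Cycle [1,3,2,6]) (Path [1,0,5,4,2,6])) (Path [2,4,5,0,1,6]))
    (Path [2,4,5,0,1,3]))) (Ask 1 2 (Ask 1 3 (Ask 3 5 (Cycle [1,2,5,3]) (Path [1,0,5,3,4,2]))
    (Path [2,4,3,1,0,5])) (Path [3,4,2,1,0,5])))) (Ask 3 4 (Ask 4 5 (Cycle [2,3,4,5]) (Ask 1 2
    (Ask 1 5 (Ask 3 5 (Cycle [1,2,3,5]) (Path [1,0,3,5,4,2])) (Path [2,4,5,1,0,3]))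
    (Path [3,0,1,2,4,5]))) (Ask 1 5 (Ask 1 6 (Ask 2 6 (Cycle [1,5,2,6]) (Path [1,0,3,4,2,6]))
    (Path [2,4,3,0,1,6])) (Path [2,4,3,0,1,5])))) (Ask 3 4 (Ask 4 6 (Ask 2 6 (Cycle [2,3,4,6])
    (Ask 3 5 (Ask 5 6 (Cycle [3,4,6,5]) (Ask 0 4 (Ask 0 5 (Cycle [0,4,3,5]) (Path [1,0,5,6,2,4]))
    (Path [1,0,4,2,5,6]))) (Ask 0 3 (Ask 0 6 (Cycle [0,3,4,6]) (Path [1,0,6,2,5,3]))
    (Path [1,0,3,5,2,4])))) (Ask 0 5 (Ask 0 6 (Ask 1 5 (Ask 1 6 (Cycle [0,5,1,6])
    (Path [0,1,6,4,2,5])) (Path [0,1,5,2,4,6])) (Path [1,0,6,4,2,5])) (Path [1,0,5,2,4,6])))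
    (Ask 0 3 (Ask 0 5 (Ask 1 3 (Ask 1 5 (Cycle [0,3,1,5]) (Path [0,1,5,2,4,3]))
    (Path [0,1,3,4,2,5])) (Path [1,0,5,2,4,3])) (Path [1,0,3,4,2,5]))))) (Ask 0 4 (Ask 0 5 (Ask 1 4
    (Ask 1 5 (Cycle [0,4,1,5]) (Ask 2 4 (Ask 2 5 (Cycle [0,4,2,5]) (Ask 0 6 (Ask 3 4 (Ask 3 6
    (Cycle [0,4,3,6]) (Path [0,1,5,2,3,6])) (Path [0,1,5,2,3,4])) (Path [3,2,5,1,0,6]))) (Ask 0 3
    (Ask 3 5 (Ask 4 5 (Cycle [0,3,5,4]) (Path [0,1,5,4,2,3])) (Path [0,1,5,3,2,4]))
    (Path [4,2,3,0,1,5])))) (Ask 2 4 (Ask 2 5 (Cycle [0,4,2,5]) (Ask 0 3 (Ask 3 4 (Ask 4 5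
    (Cycle [0,3,4,5]) (Path [0,1,4,5,2,3])) (Path [0,1,4,3,2,5])) (Path [4,1,0,3,2,5]))) (Ask 0 6
    (Ask 3 5 (Ask 3 6 (Cycle [0,5,3,6]) (Path [0,1,4,2,3,6])) (Path [0,1,4,2,3,5]))
    (Path [3,2,4,1,0,6])))) (Ask 1 4 (Ask 1 6 (Ask 0 6 (Cycle [0,4,1,6]) (Ask 4 5 (Ask 5 6
    (Cycle [1,4,5,6]) (Ask 1 2 (Ask 2 5 (Cycle [1,2,5,4]) (Path [1,0,6,5,2,3]))
    (Path [3,2,1,0,5,6]))) (Ask 2 4 (Ask 2 6 (Cycle [1,4,2,6]) (Path [3,2,6,0,5,4]))
    (Path [1,0,5,4,2,3])))) (Ask 2 5 (Ask 2 6 (Ask 3 5 (Ask 3 6 (Cycle [2,5,3,6])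
    (Path [2,3,6,1,0,5])) (Path [2,3,5,0,1,6])) (Path [3,2,6,1,0,5])) (Path [3,2,5,0,1,6])))
    (Ask 2 4 (Ask 2 5 (Ask 3 4 (Ask 3 5 (Cycle [2,4,3,5]) (Path [2,3,5,0,1,4]))
    (Path [2,3,4,1,0,5])) (Path [3,2,5,0,1,4])) (Path [3,2,4,1,0,5])))) (Ask 1 2 (Ask 1 3 (Ask 2 5
    (Ask 3 5 (Cycle [1,2,5,3]) (Ask 1 5 (Ask 2 4 (Ask 4 5 (Cycle [1,2,4,5]) (Path [1,0,4,5,3,2]))
    (Path [1,0,4,2,3,5])) (Path [2,3,5,1,0,4]))) (Ask 1 5 (Ask 3 4 (Ask 4 5 (Cycle [1,3,4,5])
    (Path [1,0,4,5,2,3])) (Path [1,0,4,3,2,5])) (Path [3,2,5,1,0,4]))) (Ask 2 5 (Ask 2 6 (Ask 4 5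
    (Ask 4 6 (Cycle [2,5,4,6]) (Path [2,3,1,0,4,6])) (Path [2,3,1,0,4,5])) (Path [4,0,1,3,2,6]))
    (Path [4,0,1,3,2,5]))) (Ask 3 5 (Ask 3 6 (Ask 4 5 (Ask 4 6 (Cycle [3,5,4,6])
    (Path [3,2,1,0,4,6])) (Path [3,2,1,0,4,5])) (Path [4,0,1,2,3,6])) (Path [4,0,1,2,3,5]))))))"

text \<open>Rewriting evaluates the checker on the closed tree. Every \<open>Ask\<close> uses up one
  of the 11 rounds, so this also bounds the depth.\<close>

lemma valid_builder_tree: "valid 11 [] [] builder_tree"
  by (simp add: builder_tree_def listed_def)

lemma builder_wins_within_11: "builder_wins_within (cycle_graph 4) (path_graph 6) 11"
  by (rule builder_wins_within_if_forces, rule forces_if_valid[OF valid_builder_tree])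
    (simp_all add: edge_set_def)

section \<open>The greedy Painter\<close>

text \<open>A walk whose vertices may repeat. What matters later is that the ends of
  \<open>e\<close> lie in one red component and, if the red graph is bipartite, on opposite
  sides.\<close>

definition three_path :: "nat set set \<Rightarrow> nat set \<Rightarrow> bool" where
  "three_path R e \<longleftrightarrow> (\<exists>a b c d. e = {a, d} \<and> {{a, b}, {b, c}, {c, d}} \<subseteq> R)"

lemma three_path_mono: "three_path R e \<Longrightarrow> R \<subseteq> S \<Longrightarrow> three_path S e"
  unfolding three_path_def by blast

text \<open>Since the four vertices are distinct, the other three edges of the cycle differ from
  \<open>e\<close> and hence lie in \<open>R\<close>.\<close>

lemma three_path_if_cycle:
  assumes "distinct [a, b, c, d]" and "e = {d, a}"
    and "{a, b} \<in> insert e R" "{b, c} \<in> insert e R" "{c, d} \<in> insert e R"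
  shows "three_path R e"
proof -
  have "{a, b} \<noteq> e" "{b, c} \<noteq> e" "{c, d} \<noteq> e"
    using assms(1,2) by (simp_all add: doubleton_eq_iff)
  then have "e = {a, d} \<and> {{a, b}, {b, c}, {c, d}} \<subseteq> R"
    using assms(2-5) by (simp add: insert_commute)
  then show ?thesis
    unfolding three_path_def by blast
qed

lemma three_path_if_closes_cycle:
  assumes "contains_copy (insert e R) (cycle_graph 4)" and "\<not> contains_copy R (cycle_graph 4)"
  shows "three_path R e"
proof -
  obtain f :: "nat \<Rightarrow> nat" where inj: "inj_on f {..<4}"
    and edge: "\<And>i. i < 4 \<Longrightarrow> {f i, f (Suc i mod 4)} \<in> insert e R"
    using assms(1) unfolding contains_copy_cycle_graph_iff by metis
  have succ: "Suc 0 mod 4 = 1" "Suc 1 mod 4 = 2" "Suc 2 mod 4 = 3" "Suc 3 mod 4 = 0"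
    by simp_all
  have cyc: "{f 0, f 1} \<in> insert e R" "{f 1, f 2} \<in> insert e R" "{f 2, f 3} \<in> insert e R"
    "{f 3, f 0} \<in> insert e R"
    using edge[of 0] edge[of 1] edge[of 2] edge[of 3]
    unfolding succ by simp_all
  have dist: "distinct [f 0, f 1, f 2, f 3]"
    using inj by (simp add: inj_on_eq_iff)
  \<comment> \<open>\<open>R\<close> contains no 4-cycle, so some edge of this one is missing from
    \<open>R\<close> and must be \<open>e\<close>. Each of its four positions reduces to the
    previous lemma by rotating the cycle until \<open>e\<close> comes last.\<close>
  obtain i where i: "i < 4" "{f i, f (Suc i mod 4)} \<notin> R"
    using assms(2) inj unfolding contains_copy_cycle_graph_iff by metis
  have e: "e = {f i, f (Suc i mod 4)}"
    using edge[OF i(1)] i(2) by simp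
  from i(1) have "i = 0 \<or> i = 1 \<or> i = 2 \<or> i = 3"
    by arith
  then have "e = {f 0, f 1} \<or> e = {f 1, f 2} \<or> e = {f 2, f 3} \<or> e = {f 3, f 0}"
    unfolding e by (elim disjE) (simp_all only: succ simp_thms)
  then show ?thesis
  proof (elim disjE)
    assume "e = {f 0, f 1}"
    from three_path_if_cycle[OF _ this cyc(2-4)] dist show ?thesis by auto
  next
    assume "e = {f 1, f 2}"
    from three_path_if_cycle[OF _ this cyc(3,4,1)] dist show ?thesis by auto
  next
    assume "e = {f 2, f 3}"
    from three_path_if_cycle[OF _ this cyc(4,1,2)] dist show ?thesis by auto
  next
    assume "e = {f 3, f 0}"
    from three_path_if_cycle[OF _ this cyc(1-3)] dist show ?thesis by auto
  qed
qed

section \<open>Bicoloured spanning trees\<close>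

text \<open>The card equation replaces connectedness: only the number of vertices is used.\<close>

definition bicolored_tree :: "nat set \<Rightarrow> nat set \<Rightarrow> nat set set \<Rightarrow> bool" where
  "bicolored_tree X Y E \<longleftrightarrow> finite X \<and> finite Y \<and> finite E \<and> X \<inter> Y = {} \<and>
     card X + card Y = Suc (card E) \<and> (\<forall>e \<in> E. \<exists>x \<in> X. \<exists>y \<in> Y. e = {x, y})"

lemma bicolored_tree_commute: "bicolored_tree X Y E \<Longrightarrow> bicolored_tree Y X E"
  unfolding bicolored_tree_def by (metis Int_commute add.commute insert_commute)

text \<open>A leaf \<open>w\<close> hung on \<open>u\<close> goes to the opposite side; vertex and
  edge counts both grow by one. The edge is new because all ends of edges in \<open>E\<close> lie in
  \<open>X\<close> or \<open>Y\<close>.\<close>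

lemma bicolored_tree_insert:
  assumes "bicolored_tree X Y E" and "u \<in> X" and "w \<notin> X \<union> Y"
  shows "bicolored_tree X (insert w Y) (insert {u, w} E)" and "{u, w} \<notin> E"
proof -
  show new: "{u, w} \<notin> E"
    using assms by (force simp: bicolored_tree_def doubleton_eq_iff)
  show "bicolored_tree X (insert w Y) (insert {u, w} E)"
    using assms new unfolding bicolored_tree_def by (auto 0 4)
qed

text \<open>Grow a tree from \<open>v\<close> by red edges that leave it, until none does. The
  vertex set is then closed under red adjacency, so it contains the red component of
  \<open>v\<close>.\<close>

lemma spanning_tree:
  assumes "finite R" and "R \<subseteq> clique_edges"
  shows "\<exists>X Y E. bicolored_tree X Y E \<and> E \<subseteq> R \<and> v \<in> X \<and>
    (\<forall>u w. {u, w} \<in> R \<longrightarrow> u \<in> X \<union> Y \<longrightarrow> w \<in> X \<union> Y)"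
proof -
  define P where "P X Y E \<longleftrightarrow> bicolored_tree X Y E \<and> E \<subseteq> R \<and> v \<in> X" for X Y E
  have "\<exists>X' Y' E'. P X' Y' E' \<and> (\<forall>u w. {u, w} \<in> R \<longrightarrow> u \<in> X' \<union> Y' \<longrightarrow> w \<in> X' \<union> Y')"
    if "P X Y E" for X Y E
    using that
  \<comment> \<open>Each extension adds a new edge to \<open>E\<close> while \<open>E\<close> stays
    inside the finite set \<open>R\<close>.\<close>
  proof (induction "card R - card E" arbitrary: X Y E rule: less_induct)
    case less
    show ?case
    proof (cases "\<forall>u w. {u, w} \<in> R \<longrightarrow> u \<in> X \<union> Y \<longrightarrow> w \<in> X \<union> Y")
      case True
      then show ?thesis
        using less.prems by blast
    next
      case False
      then obtain u w where uw: "{u, w} \<in> R" "u \<in> X \<union> Y" "w \<notin> X \<union> Y"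
        by blast
      have "\<exists>X' Y'. P X' Y' (insert {u, w} E) \<and> {u, w} \<notin> E"
      proof (cases "u \<in> X")
        case True
        then show ?thesis
          using bicolored_tree_insert[of X Y E u w] uw less.prems unfolding P_def by blast
      next
        case False
        then have "u \<in> Y"
          using uw by simp
        \<comment> \<open>Swap the two sides, insert, and swap back; \<open>v\<close> stays in
          \<open>X\<close> because \<open>X\<close> only grows.\<close>
        then show ?thesis
          using bicolored_tree_insert[of Y X E u w] bicolored_tree_commute uw less.prems
          unfolding P_def by (metis Un_commute insert_subset insertCI)
      qed
      then obtain X' Y' where P': "P X' Y' (insert {u, w} E)" and new: "{u, w} \<notin> E"
        by blast
      have "card (insert {u, w} E) \<le> card R"
        using P' assms(1) by (intro card_mono) (auto simp: P_def)
      moreover have "card (insert {u, w} E) = Suc (card E)"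
        using new less.prems by (simp add: P_def bicolored_tree_def)
      ultimately have "card R - card (insert {u, w} E) < card R - card E"
        by simp
      from less.hyps[OF this P'] show ?thesis .
    qed
  qed
  moreover have "P {v} {} {}"
    by (simp add: P_def bicolored_tree_def)
  ultimately show ?thesis
    unfolding P_def by (metis (no_types, lifting))
qed

section \<open>Counting the edges of a position with a blue path\<close>

text \<open>A statement about edge sets alone: all that survives of Painter's play is that every
  blue edge is spanned by a red walk of three edges.\<close>

lemma card_edges_ge_11:
  assumes R: "finite R" "R \<subseteq> clique_edges" and B: "finite B" and disj: "R \<inter> B = {}"
    and path: "contains_copy B (path_graph 6)" and three: "\<forall>e \<in> B. three_path R e"
  shows "11 \<le> card R + card B"
proof -
  obtain f :: "nat \<Rightarrow> nat" where inj: "inj_on f {..<6}"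
    and f: "\<And>i. Suc i < 6 \<Longrightarrow> {f i, f (Suc i)} \<in> B"
    using path unfolding contains_copy_path_graph_iff by metis
  define b where "b i = {f i, f (Suc i)}" for i
  have b: "b i \<in> B" if "i < 5" for i
    using f that by (simp add: b_def)
  have f_eq: "f i = f j \<longleftrightarrow> i = j" if "i < 6" "j < 6" for i j
    using inj that by (auto simp: inj_on_def)
  have "inj_on b {..<5}"
    by (rule inj_onI) (auto simp: b_def doubleton_eq_iff f_eq)
  then have card_b: "card (b ` {..<5}) = 5"
    by (simp add: card_image)
  have b_sub: "b ` {..<5} \<subseteq> B"
    using b by blast
  have "5 \<le> card B"
    using card_mono[OF B b_sub] card_b by simp
  moreover have "6 \<le> card R"
  proof (rule ccontr)
    assume "\<not> ?thesis"
    then have R5: "card R \<le> 5" by simp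
    obtain X Y E where tree: "bicolored_tree X Y E" and E: "E \<subseteq> R" and f0: "f 0 \<in> X"
      and closed: "\<And>u w. {u, w} \<in> R \<Longrightarrow> u \<in> X \<union> Y \<Longrightarrow> w \<in> X \<union> Y"
      using spanning_tree[OF R, of "f 0"] by metis
    have XY: "finite X" "finite Y" "X \<inter> Y = {}" "card X + card Y = Suc (card E)"
      using tree by (auto simp: bicolored_tree_def)
    \<comment> \<open>\<open>three_path\<close> speaks of an unordered edge, so the walk may have to
      be reversed to run from \<open>f i\<close> to \<open>f (Suc i)\<close>.\<close>
    have walk: "\<exists>c c'. {f i, c} \<in> R \<and> {c, c'} \<in> R \<and> {c', f (Suc i)} \<in> R" if "i < 5" for i
    proof -
      have "three_path R (b i)"
        using three b[OF that] by blast
      then obtain a c c' d where "b i = {a, d}" and R3: "{a, c} \<in> R" "{c, c'} \<in> R" "{c', d} \<in> R"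
        by (auto simp: three_path_def)
      then have "f i = a \<and> f (Suc i) = d \<or> f i = d \<and> f (Suc i) = a"
        by (auto simp: b_def doubleton_eq_iff)
      moreover have "{d, c'} \<in> R" "{c', c} \<in> R" "{c, a} \<in> R"
        using R3 by (simp_all add: insert_commute)
      ultimately show ?thesis
        using R3 by metis
    qed
    have step: "f (Suc i) \<in> X \<union> Y" if "i < 5" "f i \<in> X \<union> Y" for i
      using walk[OF that(1)] that(2) closed by metis
    have in_XY: "f i \<in> X \<union> Y" if "i < 6" for i
      using that
    proof (induction i)
      case 0
      then show ?case using f0 by simp
    next
      case (Suc i)
      then show ?case using step by simp
    qed
    have card_f: "card (f ` {..<6}) = 6"
      using inj by (simp add: card_image)
    have card_XY: "card (X \<union> Y) = Suc (card E)"
      using XY by (simp add: card_Un_disjoint)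
    \<comment> \<open>The tree contains all six path vertices, so it has at least five edges; with
      at most five red edges available, it uses all of them.\<close>
    have "6 \<le> card (X \<union> Y)"
      using card_mono[of "X \<union> Y" "f ` {..<6}"] XY in_XY card_f by auto
    then have "card R \<le> card E"
      using card_XY R5 by simp
    then have ER: "E = R"
      using card_seteq[OF R(1) E] by simp
    have XY_eq: "f ` {..<6} = X \<union> Y"
    proof (rule card_seteq)
      show "card (X \<union> Y) \<le> card (f ` {..<6})"
        using card_XY ER R5 card_f by simp
    qed (use XY in_XY in auto)
    have cross: "u \<in> X \<and> w \<in> Y \<or> u \<in> Y \<and> w \<in> X" if "{u, w} \<in> R" for u w
    proof -
      obtain x y where "x \<in> X" "y \<in> Y" "{u, w} = {x, y}"
        using tree \<open>{u, w} \<in> R\<close> ER unfolding bicolored_tree_def by meson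
      then show ?thesis
        by (auto simp: doubleton_eq_iff)
    qed
    \<comment> \<open>Three red edges, each changing sides, lead from one side to the other.\<close>
    have cross_b: "f i \<in> X \<longleftrightarrow> f (Suc i) \<in> Y" if "i < 5" for i
      using walk[OF that] cross XY(3) by (metis disjoint_iff)
    have parity: "f i \<in> (if even i then X else Y)" if "i < 6" for i
      using that
    proof (induction i)
      case 0
      then show ?case using f0 by simp
    next
      case (Suc i)
      then show ?case
        using cross_b[of i] in_XY[of "Suc i"] XY(3) by (auto split: if_splits)
    qed
    \<comment> \<open>The path alternates between the sides, which gives at least three vertices in
      each; the total is six.\<close>
    have "f ` {0, 2, 4} \<subseteq> X" "f ` {1, 3, 5} \<subseteq> Y"
      using parity[of 0] parity[of 1] parity[of 2] parity[of 3] parity[of 4] parity[of 5] by auto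
    moreover have "card (f ` {0, 2, 4}) = 3" "card (f ` {1, 3, 5}) = 3"
      by (simp_all add: f_eq)
    ultimately have "3 \<le> card X" "3 \<le> card Y"
      using card_mono XY(1,2) by metis+
    moreover have "card X + card Y = 6"
      using XY(4) \<open>6 \<le> card (X \<union> Y)\<close> card_XY ER R5 by simp
    ultimately have three_three: "card X = 3" "card Y = 3"
      by simp_all
    \<comment> \<open>The nine edges of the complete bipartite graph between \<open>X\<close> and
      \<open>Y\<close>. Five red and five blue edges, all different, would have to fit into
      it.\<close>
    let ?K = "(\<lambda>(x, y). {x, y}) ` (X \<times> Y)"
    have "card ?K \<le> card (X \<times> Y)"
      using XY by (intro card_image_le) simp
    then have "card ?K \<le> 9"
      using three_three by (simp add: card_cartesian_product)
    moreover have "R \<union> b ` {..<5} \<subseteq> ?K"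
    proof
      fix e
      assume "e \<in> R \<union> b ` {..<5}"
      then obtain u w where "e = {u, w}" "u \<in> X \<and> w \<in> Y \<or> u \<in> Y \<and> w \<in> X"
      proof
        assume "e \<in> R"
        then show ?thesis
          using R(2) cross that unfolding clique_edges_def by blast
      next
        assume "e \<in> b ` {..<5}"
        then obtain i where "i < 5" "e = b i" by auto
        then show ?thesis
          using cross_b[of i] in_XY[of i] in_XY[of "Suc i"] that[of "f i" "f (Suc i)"]
          by (auto simp: b_def)
      qed
      then show "e \<in> ?K"
        by (force simp: insert_commute)
    qed
    ultimately have "card (R \<union> b ` {..<5}) \<le> 9"
      using card_mono[of ?K] XY by (meson finite_SigmaI finite_imageI le_trans)
    moreover have "card (R \<union> b ` {..<5}) = card R + 5"
      using card_Un_disjoint[of R "b ` {..<5}"] R(1) disj b_sub card_b by auto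
    moreover have "5 \<le> card R"
      using card_XY \<open>6 \<le> card (X \<union> Y)\<close> ER by simp
    ultimately show False by simp
  qed
  ultimately show ?thesis by simp
qed

section \<open>Play against the greedy Painter\<close>

definition greedy_painter :: painter_strategy where
  "greedy_painter h e =
     (if contains_copy (insert e (colored_edges h Red)) (cycle_graph 4) then Blue else Red)"

text \<open>Legality makes each edge new, so exactly one colour class grows by one per round. An
  edge turns blue only when red would close a 4-cycle, whose other edges form the red walk; this
  walk persists as red edges are added.\<close>

lemma play_greedy_painter:
  assumes "legal_builder \<beta>"
  defines "R n \<equiv> colored_edges (play \<beta> greedy_painter n) Red"
    and "B n \<equiv> colored_edges (play \<beta> greedy_painter n) Blue"
  shows "R n \<subseteq> clique_edges \<and> R n \<inter> B n = {} \<and> card (R n) + card (B n) = n \<and>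
    \<not> contains_copy (R n) (cycle_graph 4) \<and> (\<forall>e \<in> B n. three_path (R n) e)"
proof (induction n)
  case 0
  have "\<not> contains_copy {} (cycle_graph 4)"
    unfolding contains_copy_cycle_graph_iff by (metis empty_iff zero_less_numeral)
  then show ?case
    by (simp add: R_def B_def)
next
  case (Suc n)
  let ?h = "play \<beta> greedy_painter n"
  let ?e = "\<beta> ?h"
  have fin: "finite (R n)" "finite (B n)"
    by (simp_all add: R_def B_def)
  have e: "?e \<in> clique_edges" "?e \<notin> R n" "?e \<notin> B n"
    using assms(1) by (auto simp: legal_builder_def chosen_edges_eq R_def B_def)
  show ?case
  proof (cases "contains_copy (insert ?e (R n)) (cycle_graph 4)")
    case True
    then have "R (Suc n) = R n" "B (Suc n) = insert ?e (B n)"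
      by (simp_all add: R_def B_def Let_def greedy_painter_def colored_edges_snoc)
    then show ?thesis
      using Suc e fin three_path_if_closes_cycle[OF True] by auto
  next
    case False
    then have "R (Suc n) = insert ?e (R n)" "B (Suc n) = B n"
      by (simp_all add: R_def B_def Let_def greedy_painter_def colored_edges_snoc)
    then show ?thesis
      using Suc e fin False by (auto intro: three_path_mono)
  qed
qed

lemma builder_wins_within_ge_11:
  assumes "builder_wins_within (cycle_graph 4) (path_graph 6) t"
  shows "11 \<le> t"
proof -
  obtain \<beta> where legal: "legal_builder \<beta>"
    and "\<forall>\<pi>. \<exists>s \<le> t. builder_won (cycle_graph 4) (path_graph 6) (play \<beta> \<pi> s)"
    using assms by (auto simp: builder_wins_within_def)
  then obtain s where s: "s \<le> t"
    "builder_won (cycle_graph 4) (path_graph 6) (play \<beta> greedy_painter s)"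
    by blast
  let ?c = "colored_edges (play \<beta> greedy_painter s)"
  note inv = play_greedy_painter[OF legal, of s]
  \<comment> \<open>The invariant excludes a red 4-cycle, so the win is by a blue path.\<close>
  have "contains_copy (?c Blue) (path_graph 6)"
    using s(2) inv by (simp add: builder_won_def)
  then have "11 \<le> card (?c Red) + card (?c Blue)"
    using inv by (intro card_edges_ge_11) auto
  then show ?thesis
    using s(1) inv by simp
qed

theorem theorem2: "online_size_ramsey (cycle_graph 4) (path_graph 6) = 11"
proof -
  \<comment> \<open>Brings the numeral into the form \<open>enat t\<close> of the elements of the
    infimum.\<close>
  have eleven: "(11 :: enat) = enat 11"
    by (simp add: numeral_eq_enat)
  show ?thesis
    unfolding online_size_ramsey_def eleven
  proof (rule antisym)
    show "(INF t \<in> {t. builder_wins_within (cycle_graph 4) (path_graph 6) t}. enat t) \<le> enat 11"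
      using builder_wins_within_11 by (intro INF_lower) simp
    show "enat 11 \<le> (INF t \<in> {t. builder_wins_within (cycle_graph 4) (path_graph 6) t}. enat t)"
      using builder_wins_within_ge_11 by (intro INF_greatest) simp
  qed
qed

end
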